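(* For every positive integer $n$, the order $|\widehat{S_n}|$ of the group of semicharacters of the symmetric group $S_n$ is divisible by $|S_n|=n!$.
   Context: A semicharacter of a finite group $G$ is a function $f:G\to\mathbb{C}^{*}$ satisfying $f(ab)=f(a)f(b)$ for all pairs of commuting elements $a,b\in G$. The set $\widehat{G}$ of all semicharacters of $G$ is an abelian group under pointwise multiplication (it is finite whenever $G$ is finite). *)

theory Defs
  imports Complex_Main "HOL-Library.FuncSet" "HOL-Algebra.Sym_Groups" "HOL-Algebra.Multiplicative_Group"
begin

text \<open>Semicharacters are taken extensional (equal to \<open>undefined\<close> outside \<open>carrier G\<close>), so that
  each function on the carrier is represented exactly once and \<open>order\<close> counts correctly.\<close>

definition semicharacters :: "('a, 'b) monoid_scheme \<Rightarrow> ('a \<Rightarrow> complex) set" where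
  "semicharacters G =
     {f \<in> carrier G \<rightarrow>\<^sub>E (UNIV - {0}).
        \<forall>a\<in>carrier G. \<forall>b\<in>carrier G.
          a \<otimes>\<^bsub>G\<^esub> b = b \<otimes>\<^bsub>G\<^esub> a \<longrightarrow> f (a \<otimes>\<^bsub>G\<^esub> b) = f a * f b}"

definition semicharacter_group :: "('a, 'b) monoid_scheme \<Rightarrow> ('a \<Rightarrow> complex) monoid" where
  "semicharacter_group G =
     \<lparr> carrier = semicharacters G,
       mult = (\<lambda>f g. \<lambda>x\<in>carrier G. f x * g x),
       one = (\<lambda>x\<in>carrier G. 1) \<rparr>"

lemma comm_group_semicharacter_group:
  assumes "group G"
  shows "comm_group (semicharacter_group G)"
proof -
  interpret group G by fact
  have mem: "restrict h (carrier G) \<in> semicharacters G"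
    if "\<And>a. a \<in> carrier G \<Longrightarrow> h a \<noteq> 0"
      "\<And>a b. a \<in> carrier G \<Longrightarrow> b \<in> carrier G \<Longrightarrow> a \<otimes>\<^bsub>G\<^esub> b = b \<otimes>\<^bsub>G\<^esub> a \<Longrightarrow> h (a \<otimes>\<^bsub>G\<^esub> b) = h a * h b"
    for h :: "_ \<Rightarrow> complex"
    using that by (auto simp: semicharacters_def)
  have nz: "f a \<noteq> 0" if "f \<in> semicharacters G" "a \<in> carrier G" for f a
    using that by (auto simp: semicharacters_def dest!: PiE_mem)
  have mu: "f (a \<otimes>\<^bsub>G\<^esub> b) = f a * f b"
    if "f \<in> semicharacters G" "a \<in> carrier G" "b \<in> carrier G" "a \<otimes>\<^bsub>G\<^esub> b = b \<otimes>\<^bsub>G\<^esub> a" for f a b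
    using that by (auto simp: semicharacters_def)
  have ext: "f \<in> extensional (carrier G)" if "f \<in> semicharacters G" for f
    using that by (auto simp: semicharacters_def PiE_def)
  show ?thesis
  proof (rule comm_groupI)
    fix f g assume "f \<in> carrier (semicharacter_group G)" "g \<in> carrier (semicharacter_group G)"
    then show "f \<otimes>\<^bsub>semicharacter_group G\<^esub> g \<in> carrier (semicharacter_group G)"
      by (auto simp: semicharacter_group_def nz mu intro!: mem)
  next
    show "\<one>\<^bsub>semicharacter_group G\<^esub> \<in> carrier (semicharacter_group G)"
      by (auto simp: semicharacter_group_def intro!: mem)
  next
    fix f assume f: "f \<in> carrier (semicharacter_group G)"
    then show "\<one>\<^bsub>semicharacter_group G\<^esub> \<otimes>\<^bsub>semicharacter_group G\<^esub> f = f"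
      by (auto simp: semicharacter_group_def fun_eq_iff extensional_def dest!: ext)
    show "\<exists>g\<in>carrier (semicharacter_group G).
            g \<otimes>\<^bsub>semicharacter_group G\<^esub> f = \<one>\<^bsub>semicharacter_group G\<^esub>"
      using f by (intro bexI[of _ "\<lambda>x\<in>carrier G. inverse (f x)"])
        (auto simp: semicharacter_group_def nz mu fun_eq_iff intro!: mem)
  qed (auto simp: semicharacter_group_def fun_eq_iff mult.assoc mult.commute)
qed

lemma finite_semicharacters:
  assumes "group G" "finite (carrier G)"
  shows "finite (semicharacters G)"
proof -
  interpret group G by fact
  have "f a ^ order G = 1" if f: "f \<in> semicharacters G" and a: "a \<in> carrier G" for f a
  proof -
    have mu: "f (x \<otimes>\<^bsub>G\<^esub> y) = f x * f y"
      if "x \<in> carrier G" "y \<in> carrier G" "x \<otimes>\<^bsub>G\<^esub> y = y \<otimes>\<^bsub>G\<^esub> x" for x y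
      using f that by (auto simp: semicharacters_def)
    have one: "f \<one>\<^bsub>G\<^esub> = 1"
    proof -
      have "f \<one>\<^bsub>G\<^esub> \<noteq> 0" using f by (auto simp: semicharacters_def dest!: PiE_mem)
      then show ?thesis using mu[of "\<one>\<^bsub>G\<^esub>" "\<one>\<^bsub>G\<^esub>"] by simp
    qed
    have "f (a [^]\<^bsub>G\<^esub> k) = f a ^ k" for k :: nat
      by (induction k) (use a one in \<open>simp_all add: mu nat_pow_comm nat_pow_Suc2[symmetric]\<close>)
    then show ?thesis using pow_order_eq_1[OF a] one by metis
  qed
  then have "semicharacters G \<subseteq> carrier G \<rightarrow>\<^sub>E {z. z ^ order G = 1}"
    by (auto simp: semicharacters_def intro!: PiE_I)
  moreover have "order G > 0" using assms(2) order_gt_0_iff_finite by blast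
  then have "finite (carrier G \<rightarrow>\<^sub>E {z :: complex. z ^ order G = 1})"
    using assms(2) by (intro finite_PiE finite_roots_unity) auto
  ultimately show ?thesis by (rule finite_subset)
qed

end

theory Submission
  imports Defs "HOL-Number_Theory.Cong" "HOL-Combinatorics.Multiset_Permutations"
begin

text \<open>Let \<open>p \<le> n\<close> be prime and \<open>q = p ^ k\<close> the largest power of \<open>p\<close> that is at most \<open>n\<close>. Given a \<open>q\<close>-cycle
  \<open>c\<close> with support \<open>S\<close>, send a \<open>p\<close>-element \<open>x\<close> that acts on \<open>S\<close> as \<open>c ^ j\<close> to \<open>\<omega> ^ j\<close>, where \<open>\<omega>\<close> is a
  primitive \<open>p\<close>-th root of unity, and every other \<open>p\<close>-element to \<open>1\<close>. This is multiplicative on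
  commuting pairs: if \<open>p\<close> does not divide \<open>j\<close>, then any \<open>p\<close>-element commuting with \<open>x\<close> also acts
  on \<open>S\<close> as a power of \<open>c\<close>, because \<open>n < p * q\<close>. Composing with the projection of a permutation to
  its \<open>p\<close>-part gives a semicharacter of order \<open>p\<close>, and different cyclic groups generated by
  \<open>q\<close>-cycles give independent semicharacters. There are at least as many such cyclic groups as the
  exponent of \<open>p\<close> in \<open>n!\<close>, which is less than \<open>n\<close>.\<close>

section \<open>Rotations of a list\<close>

lemma rotate_eq_rotate_iff:
  assumes "distinct xs" "xs \<noteq> []"
  shows "rotate i xs = rotate j xs \<longleftrightarrow> [i = j] (mod length xs)"
proof
  assume "rotate i xs = rotate j xs"
  then have "rotate i xs ! 0 = rotate j xs ! 0" by simp
  then show "[i = j] (mod length xs)"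
    using assms by (simp add: nth_rotate cong_def nth_eq_iff_index_eq)
next
  assume "[i = j] (mod length xs)"
  then show "rotate i xs = rotate j xs"
    by (metis cong_def rotate_conv_mod)
qed

lemma map_comp_rotate:
  assumes "map x xs = rotate i xs" "map y xs = rotate j xs"
  shows "map (x \<circ> y) xs = rotate (i + j) xs"
proof -
  have "map (x \<circ> y) xs = map x (rotate j xs)"
    using assms(2) by (metis map_map)
  also have "\<dots> = rotate j (rotate i xs)"
    by (metis assms(1) rotate_map)
  finally show ?thesis by (simp add: rotate_rotate add.commute)
qed

lemma map_funpow_rotate:
  assumes "map x xs = rotate i xs"
  shows "map (x ^^ l) xs = rotate (l * i) xs"
proof (induction l)
  case 0
  then show ?case by simp
next
  case (Suc l)
  then show ?case using map_comp_rotate[OF assms Suc.IH] by (simp add: comp_def)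
qed

text \<open>Rotation commutes with \<open>map\<close>, so the shift by \<open>j\<close> is undone by
  a further shift that completes it to a multiple of the length.\<close>

lemma map_rotate_cancel:
  assumes xy: "map (x \<circ> y) xs = rotate l xs" and y: "map y xs = rotate j xs"
  shows "\<exists>i. map x xs = rotate i xs"
proof (cases "xs = []")
  case False
  define j' where "j' = (length xs - 1) * j"
  have jj': "j' + j = length xs * j"
    using False by (cases xs) (auto simp: j'_def algebra_simps)
  have "rotate j (map x xs) = map x (rotate j xs)" by (simp add: rotate_map)
  also have "\<dots> = rotate l xs" using xy y by (metis map_map)
  finally have "rotate (j' + j) (map x xs) = rotate (j' + l) xs"
    by (metis rotate_rotate)
  moreover have "rotate (j' + j) (map x xs) = map x xs"
    unfolding jj' by (rule rotate_id) simp
  ultimately show ?thesis by metis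
qed simp

section \<open>Commuting permutations and the support of a cycle\<close>

lemma funpow_commute_apply:
  assumes "x \<circ> y = y \<circ> x"
  shows "(x ^^ s) ((y ^^ t) a) = (y ^^ t) ((x ^^ s) a)"
proof -
  have c: "x (y b) = y (x b)" for b using assms by (metis comp_apply)
  have 1: "x ((y ^^ t) b) = (y ^^ t) (x b)" for b by (induction t) (simp_all add: c)
  show ?thesis by (induction s) (simp_all add: 1)
qed

lemma funpow_comp_commute:
  assumes "x \<circ> y = y \<circ> x"
  shows "(x \<circ> y) ^^ m = (x ^^ m) \<circ> (y ^^ m)"
proof
  show "((x \<circ> y) ^^ m) a = ((x ^^ m) \<circ> (y ^^ m)) a" for a
  proof (induction m)
    case (Suc m)
    then show ?case using funpow_commute_apply[OF assms, of m 1] by simp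
  qed simp
qed

text \<open>If \<open>y\<close> moved the support of the cycle of \<open>x\<close> off itself, then the first \<open>p\<close> of its translates
  under powers of \<open>y\<close> would be disjoint, for which \<open>A\<close> is too small. A permutation that preserves
  the support and commutes with the cycle is a power of it there.\<close>

lemma commuting_p_element_rotates:
  fixes x y :: "'a \<Rightarrow> 'a"
  assumes p: "prime p" and len: "length xs = p ^ k"
    and dist: "distinct xs" and sub: "set xs \<subseteq> A" and fin: "finite A"
    and small: "card A < p * length xs"
    and perm: "y permutes A" and ord: "y ^^ (p ^ e) = id" and comm: "x \<circ> y = y \<circ> x"
    and rot: "map x xs = rotate i xs" and unit: "\<not> p dvd i"
  shows "\<exists>j. map y xs = rotate j xs"
proof -
  let ?q = "length xs" and ?S = "set xs"
  have q0: "?q > 0" using len p by (simp add: prime_gt_0_nat)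
  then have ne: "xs \<noteq> []" by auto
  \<comment> \<open>The shift \<open>i\<close> is invertible modulo the length, so some power
    \<open>z\<close> of \<open>x\<close> rotates \<open>xs\<close> by exactly one. It is transitive
    on the support and still commutes with \<open>y\<close>.\<close>
  have "coprime i ?q"
    unfolding len coprime_power_right_iff
    using p unit prime_imp_coprime coprime_commute by blast
  then obtain l where l: "[i * l = 1] (mod ?q)"
    using cong_solve_coprime_nat by auto
  define z where "z = x ^^ l"
  have "map z xs = rotate (l * i) xs" unfolding z_def by (rule map_funpow_rotate[OF rot])
  also have "\<dots> = rotate 1 xs"
    using l by (simp only: rotate_eq_rotate_iff[OF dist ne] mult.commute)
  finally have z1: "map z xs = rotate 1 xs" .
  have zt: "map (z ^^ t) xs = rotate t xs" for t
    using map_funpow_rotate[OF z1, of t] by simp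
  have znth: "(z ^^ t) (xs ! u) = xs ! ((t + u) mod ?q)" if "u < ?q" for t u
    using arg_cong[OF zt[of t], of "\<lambda>ys. ys ! u"] that by (simp add: nth_rotate)
  have zS: "(z ^^ t) a \<in> ?S" if "a \<in> ?S" for t a
    using that q0 by (metis in_set_conv_nth mod_less_divisor znth)
  have trans: "\<exists>t. (z ^^ t) a = b" if "a \<in> ?S" "b \<in> ?S" for a b
  proof -
    obtain u where "u < ?q" "a = xs ! u" using \<open>a \<in> ?S\<close> by (metis in_set_conv_nth)
    moreover obtain v where "v < ?q" "b = xs ! v" using \<open>b \<in> ?S\<close> by (metis in_set_conv_nth)
    ultimately have "(z ^^ (v + ?q - u)) a = b" by (simp add: znth)
    then show ?thesis by blast
  qed
  have zy: "z \<circ> y = y \<circ> z"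
    using funpow_commute_apply[OF comm, of l 1] by (auto simp: z_def fun_eq_iff)
  \<comment> \<open>Commutation with the transitive \<open>z\<close> carries the return of one point
    over to every point of the support.\<close>
  have stab: "(y ^^ d) b \<in> ?S" if "a \<in> ?S" "(y ^^ d) a \<in> ?S" "b \<in> ?S" for d a b
  proof -
    obtain t where "(z ^^ t) a = b" using trans[OF \<open>a \<in> ?S\<close> \<open>b \<in> ?S\<close>] by blast
    then have "(y ^^ d) b = (z ^^ t) ((y ^^ d) a)"
      using funpow_commute_apply[OF zy] by metis
    then show ?thesis using zS that by simp
  qed
  have head: "xs ! 0 \<in> ?S" using q0 by simp
  have "y (xs ! 0) \<in> ?S"
  proof (rule ccontr)
    assume out: "y (xs ! 0) \<notin> ?S"
    have off: "(y ^^ d) a \<notin> ?S" if d: "0 < d" "d < p" and a: "a \<in> ?S" for d a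
    proof
      assume in_S: "(y ^^ d) a \<in> ?S"
      have *: "(y ^^ (d * u)) b \<in> ?S" if "b \<in> ?S" for u b
      proof (induction u)
        case (Suc u)
        then show ?case using stab[OF a in_S Suc.IH] by (simp add: funpow_add)
      qed (use that in simp)
      \<comment> \<open>As \<open>d\<close> is invertible modulo \<open>p ^ e\<close>,
        \<open>y\<close> is a power of \<open>y ^^ d\<close> and would itself preserve the
        support.\<close>
      have "coprime d (p ^ e)"
        using p d by (metis coprime_commute coprime_power_left_iff nat_dvd_not_less prime_imp_coprime)
      then obtain u where u: "[d * u = 1] (mod p ^ e)"
        using cong_solve_coprime_nat by (metis One_nat_def)
      have fm: "(y ^^ (m mod p ^ e)) b = (y ^^ m) b" for m b
        by (rule funpow_mod_eq) (simp add: ord)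
      have "(y ^^ (d * u)) b = y b" for b
        using fm[of "d * u" b] fm[of 1 b] u by (simp add: cong_def)
      then show False using *[OF head, of u] out by simp
    qed
    have inj: "inj (y ^^ a)" for a
      using perm by (simp add: inj_fn permutes_inj)
    have less: "\<not> a < b"
      if eq: "(y ^^ a) s = (y ^^ b) t" and "a < p" "b < p" "s \<in> ?S" "t \<in> ?S" for a b s t
    proof
      assume "a < b"
      then have "(y ^^ b) t = (y ^^ a) ((y ^^ (b - a)) t)"
        by (metis comp_apply funpow_add le_add_diff_inverse less_imp_le)
      then have "s = (y ^^ (b - a)) t" using eq inj by (metis injD)
      then show False using off[of "b - a" t] \<open>a < b\<close> that by auto
    qed
    \<comment> \<open>The translates are pairwise disjoint copies of the support, which puts
      \<open>p * length xs\<close> points into \<open>A\<close>.\<close>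
    have "inj_on (\<lambda>(a, s). (y ^^ a) s) ({..<p} \<times> ?S)"
    proof (rule inj_onI, clarsimp)
      fix a s b t
      assume h: "a < p" "s \<in> ?S" "b < p" "t \<in> ?S" "(y ^^ a) s = (y ^^ b) t"
      then have "a = b" using less[of a s b t] less[of b t a s] by force
      then show "a = b \<and> s = t" using h inj by (metis injD)
    qed
    moreover have "(\<lambda>(a, s). (y ^^ a) s) ` ({..<p} \<times> ?S) \<subseteq> A"
    proof clarsimp
      fix a s assume "s \<in> ?S"
      then show "(y ^^ a) s \<in> A"
        using sub perm by (induction a) (auto simp: permutes_in_image)
    qed
    ultimately have "card ({..<p} \<times> ?S) \<le> card A"
      using fin card_inj_on_le by blast
    then show False
      using small dist by (simp add: card_cartesian_product distinct_card)
  qed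
  then obtain j where j: "j < ?q" "y (xs ! 0) = xs ! j"
    by (auto simp: in_set_conv_nth)
  have "map y xs = rotate j xs"
  proof (rule nth_equalityI)
    fix u assume "u < length (map y xs)"
    then have u: "u < ?q" by simp
    \<comment> \<open>Commutation with \<open>z\<close> propagates the value of \<open>y\<close> at
      the head to every other entry.\<close>
    have "y (xs ! u) = y ((z ^^ u) (xs ! 0))" using u q0 by (simp add: znth)
    also have "\<dots> = (z ^^ u) (xs ! j)"
      using funpow_commute_apply[OF zy, of u 1 "xs ! 0"] j by simp
    also have "\<dots> = xs ! ((j + u) mod ?q)" using j by (simp add: znth add.commute)
    finally show "map y xs ! u = rotate j xs ! u" using u by (simp add: nth_rotate)
  qed simp
  then show ?thesis ..
qed

section \<open>The semicharacter of a long cycle\<close>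

lemma cis_power_inject:
  fixes p i j :: nat
  assumes "p > 0" "i < p" "j < p" "cis (2 * pi / p) ^ i = cis (2 * pi / p) ^ j"
  shows "i = j"
proof -
  have "inj_on (\<lambda>k. cis (2 * pi * real k / real p)) {..<p}"
    using bij_betw_roots_unity[OF assms(1)] by (rule bij_betw_imp_inj_on)
  moreover have "cis (2 * pi / p) ^ k = cis (2 * pi * real k / real p)" for k
    by (simp add: DeMoivre mult_ac)
  ultimately show ?thesis using assms by (auto dest: inj_onD)
qed

lemma cis_power_self [simp]: "p > 0 \<Longrightarrow> cis (2 * pi / real p) ^ p = 1"
  by (simp add: DeMoivre)

lemma root_power_cong:
  fixes w :: "'a :: monoid_mult"
  assumes "w ^ p = 1" "[i = j] (mod p)"
  shows "w ^ i = w ^ j"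
proof -
  have "w ^ n = w ^ (n mod p)" for n
    using assms(1) by (metis mult.left_neutral mult_div_mod_eq power_add power_mult power_one)
  then show ?thesis using assms(2) by (metis cong_def)
qed

text \<open>For distinct nonempty \<open>xs\<close>, the exponent picked by \<open>SOME\<close> is
  determined only modulo \<open>length xs\<close>; the resulting power does not depend on the choice
  once \<open>p\<close> divides that length.\<close>

definition rot_char :: "nat \<Rightarrow> 'a list \<Rightarrow> ('a \<Rightarrow> 'a) \<Rightarrow> complex" where
  "rot_char p xs x =
     (if \<exists>j. map x xs = rotate j xs then cis (2 * pi / p) ^ (SOME j. map x xs = rotate j xs) else 1)"

lemma rot_char_eq:
  assumes "distinct xs" "xs \<noteq> []" "p > 0" "p dvd length xs" "map x xs = rotate j xs"
  shows "rot_char p xs x = cis (2 * pi / p) ^ j"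
proof -
  let ?j = "SOME j. map x xs = rotate j xs"
  have "map x xs = rotate ?j xs" using assms(5) by (rule someI)
  then have "[?j = j] (mod length xs)"
    using assms rotate_eq_rotate_iff by metis
  then have "[?j = j] (mod p)" using assms(4) cong_dvd_modulus_nat by blast
  then show ?thesis using assms(3,5) root_power_cong[OF cis_power_self] by (auto simp: rot_char_def)
qed

lemma rot_char_power:
  assumes "p > 0"
  shows "rot_char p xs x ^ p = 1"
proof -
  have "(cis (2 * pi / p) ^ j) ^ p = 1" for j
    using assms by (metis cis_power_self power_commutes power_mult power_one mult.commute)
  then show ?thesis by (auto simp: rot_char_def)
qed

text \<open>If both factors rotate \<open>xs\<close>, the shifts add. If exactly one does, the
  product does not, and the shift of the rotating factor is divisible by \<open>p\<close>, as
  otherwise its commuting partner would rotate \<open>xs\<close> too; all values are then 1.\<close>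

lemma rot_char_mult:
  fixes x y :: "'a \<Rightarrow> 'a"
  assumes p: "prime p" and len: "length xs = p ^ k" and k: "k > 0"
    and dist: "distinct xs" and sub: "set xs \<subseteq> A" and fin: "finite A"
    and small: "card A < p * length xs"
    and x: "x permutes A" "x ^^ (p ^ e) = id" and y: "y permutes A" "y ^^ (p ^ e) = id"
    and comm: "x \<circ> y = y \<circ> x"
  shows "rot_char p xs (x \<circ> y) = rot_char p xs x * rot_char p xs y"
proof -
  define R where "R u \<longleftrightarrow> (\<exists>j. map u xs = rotate j xs)" for u
  have p0: "p > 0" using p prime_gt_0_nat by blast
  have ne: "xs \<noteq> []" using len p0 by auto
  have pq: "p dvd length xs" using len k by (simp add: dvd_power)
  note val = rot_char_eq[OF dist ne p0 pq]
  have triv: "rot_char p xs u = 1" if "\<not> R u" for u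
    using that by (simp add: rot_char_def R_def)
  have key: "rot_char p xs u = 1"
    if "R u" "\<not> R v" "v permutes A" "v ^^ (p ^ e) = id" "u \<circ> v = v \<circ> u" for u v
  proof -
    obtain i where i: "map u xs = rotate i xs" using \<open>R u\<close> R_def by blast
    have "p dvd i"
      using commuting_p_element_rotates[OF p len dist sub fin small that(3,4,5) i] that(2) R_def by blast
    then have "cis (2 * pi / p) ^ i = cis (2 * pi / p) ^ 0"
      by (intro root_power_cong[OF cis_power_self[OF p0]]) (simp add: cong_0_iff)
    then show ?thesis using val[OF i] by simp
  qed
  have cancel: "R u" if "R (u \<circ> v)" "R v" for u v
    using that map_rotate_cancel unfolding R_def by blast
  have closed: "R (u \<circ> v)" if "R u" "R v" for u v
    using that map_comp_rotate unfolding R_def by blast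
  show ?thesis
  proof (cases "R x"; cases "R y")
    assume "R x" "R y"
    then obtain i j where "map x xs = rotate i xs" "map y xs = rotate j xs"
      unfolding R_def by blast
    then show ?thesis using map_comp_rotate[of x xs i y j] val by (simp add: power_add)
  next
    assume a: "R x" "\<not> R y"
    then have "\<not> R (x \<circ> y)" using cancel[of y x] comm by metis
    then show ?thesis using a triv key[OF a y comm] by simp
  next
    assume a: "\<not> R x" "R y"
    then have "\<not> R (x \<circ> y)" using cancel[of x y] by metis
    then show ?thesis using a triv key[OF a(2,1) x comm[symmetric]] by simp
  next
    assume a: "\<not> R x" "\<not> R y"
    \<comment> \<open>The product may rotate \<open>xs\<close> although neither factor does. It
      commutes with \<open>x\<close>, so its shift is then divisible by \<open>p\<close>.\<close>
    have c: "(x \<circ> y) \<circ> x = x \<circ> (x \<circ> y)" using comm by (metis comp_assoc)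
    have "rot_char p xs (x \<circ> y) = 1"
      using key[OF _ a(1) x c] triv by blast
    then show ?thesis using a triv by simp
  qed
qed

section \<open>Independent families of semicharacters\<close>

text \<open>The products of powers of the \<open>\<chi> i\<close> form a subgroup, parametrized by
  exponent vectors modulo \<open>p\<close>. Evaluation at \<open>g k\<close> recovers the coordinate
  \<open>k\<close>, so distinct vectors give distinct elements, and Lagrange applies.\<close>

lemma power_dvd_order_semicharacter_group:
  assumes G: "group G" "finite (carrier G)" and I: "finite I" and p: "p > 0"
    and chi: "\<And>i. i \<in> I \<Longrightarrow> \<chi> i \<in> semicharacters G"
    and root: "\<And>i a. i \<in> I \<Longrightarrow> a \<in> carrier G \<Longrightarrow> \<chi> i a ^ p = 1"
    and g: "\<And>i. i \<in> I \<Longrightarrow> g i \<in> carrier G"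
    and diag: "\<And>i. i \<in> I \<Longrightarrow> \<chi> i (g i) = cis (2 * pi / p)"
    and off: "\<And>i k. i \<in> I \<Longrightarrow> k \<in> I \<Longrightarrow> i \<noteq> k \<Longrightarrow> \<chi> i (g k) = 1"
  shows "p ^ card I dvd order (semicharacter_group G)"
proof -
  interpret G: group G by fact
  interpret D: comm_group "semicharacter_group G"
    using G(1) by (rule comm_group_semicharacter_group)
  let ?D = "semicharacter_group G"
  define \<Phi> where "\<Phi> a = (\<lambda>x\<in>carrier G. \<Prod>i\<in>I. \<chi> i x ^ a i)" for a :: "_ \<Rightarrow> nat"
  define H where "H = range \<Phi>"
  have nz: "\<chi> i x \<noteq> 0" if "i \<in> I" "x \<in> carrier G" for i x
    using root[OF that] p by (auto simp: power_0_left)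
  have mem: "\<Phi> a \<in> carrier ?D" for a
  proof -
    have "\<Phi> a (x \<otimes>\<^bsub>G\<^esub> y) = \<Phi> a x * \<Phi> a y"
      if xy: "x \<in> carrier G" "y \<in> carrier G" "x \<otimes>\<^bsub>G\<^esub> y = y \<otimes>\<^bsub>G\<^esub> x" for x y
    proof -
      have "\<chi> i (x \<otimes>\<^bsub>G\<^esub> y) = \<chi> i x * \<chi> i y" if "i \<in> I" for i
        using chi[OF that] xy unfolding semicharacters_def by blast
      then show ?thesis
        using xy by (simp add: \<Phi>_def power_mult_distrib prod.distrib cong: prod.cong)
    qed
    moreover have "\<Phi> a \<in> carrier G \<rightarrow>\<^sub>E UNIV - {0}"
      using nz I by (auto simp: \<Phi>_def)
    ultimately show ?thesis
      unfolding semicharacter_group_def semicharacters_def by simp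
  qed
  have mult: "\<Phi> a \<otimes>\<^bsub>?D\<^esub> \<Phi> b = \<Phi> (\<lambda>i. a i + b i)" for a b
    by (auto simp: \<Phi>_def semicharacter_group_def power_add prod.distrib fun_eq_iff)
  have one: "\<Phi> (\<lambda>i. p * a i) = \<one>\<^bsub>?D\<^esub>" for a
    by (auto simp: \<Phi>_def semicharacter_group_def power_mult root fun_eq_iff)
  have "subgroup H ?D"
  proof (rule D.subgroupI)
    show "H \<subseteq> carrier ?D" using mem by (auto simp: H_def)
    show "H \<noteq> {}" by (simp add: H_def)
  next
    fix f assume "f \<in> H"
    then obtain a where f: "f = \<Phi> a" by (auto simp: H_def)
    \<comment> \<open>The factor \<open>p - 1\<close> plays the role of -1, because exponents are
      natural numbers and \<open>p\<close>-th powers are trivial.\<close>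
    have "(p - 1) * a i + a i = p * a i" for i
      using p by (cases p) auto
    then have "\<Phi> (\<lambda>i. (p - 1) * a i) \<otimes>\<^bsub>?D\<^esub> f = \<one>\<^bsub>?D\<^esub>"
      by (simp add: f mult one)
    then have "inv\<^bsub>?D\<^esub> f = \<Phi> (\<lambda>i. (p - 1) * a i)"
      by (rule D.inv_equality) (simp_all add: f mem)
    then show "inv\<^bsub>?D\<^esub> f \<in> H" by (simp add: H_def)
  next
    fix f h assume "f \<in> H" "h \<in> H"
    then show "f \<otimes>\<^bsub>?D\<^esub> h \<in> H" by (auto simp: H_def mult)
  qed
  then have "card H dvd order ?D"
    using D.lagrange by (metis dvd_triv_right)
  moreover have "card H = p ^ card I"
  proof -
    \<comment> \<open>All factors except the one with index \<open>k\<close> are 1 at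
      \<open>g k\<close>.\<close>
    have eval: "\<Phi> a (g k) = cis (2 * pi / p) ^ a k" if k: "k \<in> I" for a k
    proof -
      have "\<Phi> a (g k) = (\<Prod>i\<in>I. if i = k then cis (2 * pi / p) ^ a k else 1)"
        using g[OF k] by (auto simp: \<Phi>_def diag off k intro!: prod.cong)
      then show ?thesis using I k by simp
    qed
    have "H = \<Phi> ` (I \<rightarrow>\<^sub>E {..<p})"
    proof
      show "H \<subseteq> \<Phi> ` (I \<rightarrow>\<^sub>E {..<p})"
      proof
        fix f assume "f \<in> H"
        then obtain a where f: "f = \<Phi> a" by (auto simp: H_def)
        have "\<chi> i x ^ a i = \<chi> i x ^ (a i mod p)" if "i \<in> I" "x \<in> carrier G" for i x
          by (rule root_power_cong[OF root[OF that]]) (simp add: cong_def)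
        then have "f = \<Phi> (\<lambda>i\<in>I. a i mod p)"
          unfolding f \<Phi>_def by (auto intro!: restrict_ext prod.cong)
        then show "f \<in> \<Phi> ` (I \<rightarrow>\<^sub>E {..<p})" using p by auto
      qed
    qed (auto simp: H_def)
    moreover have "inj_on \<Phi> (I \<rightarrow>\<^sub>E {..<p})"
    proof (rule inj_onI)
      fix a b assume a: "a \<in> I \<rightarrow>\<^sub>E {..<p}" and b: "b \<in> I \<rightarrow>\<^sub>E {..<p}" and eq: "\<Phi> a = \<Phi> b"
      show "a = b"
      proof (rule PiE_ext[OF a b])
        fix k assume k: "k \<in> I"
        show "a k = b k"
          using eval[OF k, of a] eval[OF k, of b] eq PiE_mem[OF a k] PiE_mem[OF b k] p
          by (intro cis_power_inject[of p]) auto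
      qed
    qed
    ultimately show ?thesis
      using I by (simp add: card_image card_PiE)
  qed
  ultimately show ?thesis by simp
qed

section \<open>Permutations of \<open>{1..n}\<close> and their \<open>p\<close>-parts\<close>

lemma sym_group_nat_pow: "x [^]\<^bsub>sym_group n\<^esub> (m :: nat) = x ^^ m"
proof -
  interpret group "sym_group n" by (rule sym_group_is_group)
  show ?thesis
    by (induction m) (simp_all add: sym_group_mult sym_group_one funpow_Suc_right del: funpow.simps(2))
qed

lemma order_sym_group: "order (sym_group n) = fact n"
  using sym_group_card_carrier by (simp add: order_def)

lemma permutes_funpow_fact:
  assumes "x permutes {1..n}"
  shows "x ^^ fact n = id"
proof -
  interpret group "sym_group n" by (rule sym_group_is_group)
  show ?thesis
    using order_sym_group pow_order_eq_1[of x] assms by (simp add: sym_group_carrier sym_group_nat_pow sym_group_one)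
qed

text \<open>Raising to the power \<open>M\<close> projects a permutation of \<open>{1..n}\<close> to a \<open>p\<close>-element and fixes
  \<open>p ^ k\<close>-cycles.\<close>

lemma p_part_exponent:
  fixes p n :: nat
  assumes p: "prime p" and q: "p ^ k \<le> n"
  obtains M e where "[M = 1] (mod p ^ k)" "fact n dvd M * p ^ e"
proof -
  let ?v = "multiplicity p (fact n :: nat)"
  have dvd: "p ^ k dvd (fact n :: nat)"
    using p q by (intro dvd_fact) (simp_all add: prime_gt_0_nat Suc_leI)
  have np: "\<not> is_unit p" using p by auto
  obtain r where r: "(fact n :: nat) = p ^ ?v * r" "\<not> p dvd r"
    using multiplicity_decompose'[of "fact n :: nat" p] np by auto
  \<comment> \<open>The Chinese remainder theorem gives an exponent that preserves elements of
    \<open>p\<close>-power order and kills those of order prime to \<open>p\<close>.\<close>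
  have "coprime (p ^ ?v) r" using p r(2) by (simp add: prime_imp_coprime)
  then obtain M where M: "[M = 1] (mod p ^ ?v)" "[M = 0] (mod r)"
    using binary_chinese_remainder_nat by blast
  have "k \<le> ?v" using dvd np by (simp add: power_dvd_iff_le_multiplicity)
  then have "[M = 1] (mod p ^ k)" using M(1) cong_dvd_modulus_nat le_imp_power_dvd by blast
  moreover have "fact n dvd M * p ^ ?v"
    using M(2) r(1) by (metis cong_0_iff dvd_refl mult.commute mult_dvd_mono)
  ultimately show ?thesis using that by blast
qed

text \<open>Reduces the problem to finding many lists. The assumption \<open>indep\<close> makes
  each character trivial on the cycles of the other lists, which is the diagonal form needed for
  independence.\<close>

lemma prime_power_card_dvd_order:
  fixes p k n :: nat and I :: "nat list set"
  assumes p: "prime p" and k: "k > 0" and q: "p ^ k \<le> n" "n < p * p ^ k"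
    and I: "finite I"
    and lists: "\<And>xs. xs \<in> I \<Longrightarrow> distinct xs \<and> length xs = p ^ k \<and> set xs \<subseteq> {1..n}"
    and indep: "\<And>xs ys j. xs \<in> I \<Longrightarrow> ys \<in> I \<Longrightarrow> xs \<noteq> ys \<Longrightarrow>
                  map (cycle_of_list xs) ys = rotate j ys \<Longrightarrow> p dvd j"
  shows "p ^ card I dvd order (semicharacter_group (sym_group n))"
proof -
  let ?G = "sym_group n" and ?w = "cis (2 * pi / p)"
  obtain M e where M: "[M = 1] (mod p ^ k)" "fact n dvd M * p ^ e"
    using p_part_exponent[OF p q(1)] by blast
  have p0: "p > 0" using p prime_gt_0_nat by blast
  have fin: "finite (carrier ?G)"
    by (simp add: sym_group_def finite_permutations)
  have cyc: "cycle_of_list xs permutes {1..n}" if "xs \<in> I" for xs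
    using lists[OF that] cycle_permutes permutes_subset by blast
  \<comment> \<open>As \<open>M\<close> is 1 modulo the cycle length, the cycles survive the
    projection and can serve as test elements.\<close>
  have cycM: "cycle_of_list xs ^^ M = cycle_of_list xs" if "xs \<in> I" for xs
  proof
    fix a
    have "(cycle_of_list xs ^^ (m mod p ^ k)) a = (cycle_of_list xs ^^ m) a" for m
      using lists[OF that] by (intro funpow_mod_eq) (metis cycle_is_id_root id_apply)
    from this[of M] this[of 1] show "(cycle_of_list xs ^^ M) a = cycle_of_list xs a"
      using M(1) by (simp add: cong_def)
  qed
  \<comment> \<open>Taking the power \<open>M\<close> first makes the argument a
    \<open>p\<close>-element, for which \<open>rot_char\<close> is multiplicative on commuting
    pairs.\<close>
  define \<chi> where "\<chi> xs = (\<lambda>x\<in>carrier ?G. rot_char p xs (x ^^ M))" for xs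
  show ?thesis
  proof (rule power_dvd_order_semicharacter_group[where \<chi> = \<chi> and g = cycle_of_list,
        OF sym_group_is_group fin I p0])
    fix xs assume xs: "xs \<in> I"
    note L = lists[OF xs, THEN conjunct1] lists[OF xs, THEN conjunct2, THEN conjunct1]
      lists[OF xs, THEN conjunct2, THEN conjunct2]
    have ne: "xs \<noteq> []" and pl: "p dvd length xs" using L(2) p0 k by (auto simp: dvd_power)
    show root: "\<chi> xs x ^ p = 1" if "x \<in> carrier ?G" for x
      using that p0 by (simp add: \<chi>_def rot_char_power)
    have ord: "(x ^^ M) ^^ (p ^ e) = id" if x: "x permutes {1..n}" for x
    proof -
      obtain r where r: "M * p ^ e = fact n * r" using M(2) by blast
      show ?thesis
        unfolding funpow_mult r unfolding funpow_mult[symmetric] permutes_funpow_fact[OF x]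
        by simp
    qed
    have perm: "x ^^ M permutes {1..n}" if "x permutes {1..n}" for x
      using that by (induction M) (auto intro: permutes_compose simp: permutes_id)
    have mu: "\<chi> xs (x \<circ> y) = \<chi> xs x * \<chi> xs y"
      if x: "x permutes {1..n}" and y: "y permutes {1..n}" and c: "x \<circ> y = y \<circ> x" for x y
    proof -
      have "x ^^ M \<circ> y ^^ M = y ^^ M \<circ> x ^^ M"
        using funpow_commute_apply[OF c] by (auto simp: fun_eq_iff)
      then have "rot_char p xs (x ^^ M \<circ> y ^^ M) = rot_char p xs (x ^^ M) * rot_char p xs (y ^^ M)"
        using q L
        by (intro rot_char_mult[OF p L(2) k L(1) L(3) _ _ perm[OF x] ord[OF x] perm[OF y] ord[OF y]])
          auto
      then show ?thesis
        using x y permutes_compose[OF y x] funpow_comp_commute[OF c]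
        by (simp add: \<chi>_def sym_group_carrier)
    qed
    have "\<chi> xs x \<noteq> 0" if "x \<in> carrier ?G" for x
      using root[OF that] p0 by (auto simp: power_0_left)
    moreover have "\<chi> xs \<in> extensional (carrier ?G)" by (simp add: \<chi>_def)
    ultimately show "\<chi> xs \<in> semicharacters ?G"
      using mu by (auto simp: semicharacters_def PiE_def sym_group_carrier sym_group_mult)
    show "cycle_of_list xs \<in> carrier ?G"
      using cyc[OF xs] by (simp add: sym_group_carrier)
    have "map (cycle_of_list xs) xs = rotate 1 xs"
      using cyclic_rotation[OF L(1), of 1] by simp
    then show "\<chi> xs (cycle_of_list xs) = ?w"
      using rot_char_eq[OF L(1) ne p0 pl, of _ 1] cyc[OF xs] cycM[OF xs]
      by (simp add: \<chi>_def sym_group_carrier)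
    fix ys assume ys: "ys \<in> I" and "xs \<noteq> ys"
    have "rot_char p xs (cycle_of_list ys) = 1"
    proof (cases "\<exists>j. map (cycle_of_list ys) xs = rotate j xs")
      case True
      then obtain j where j: "map (cycle_of_list ys) xs = rotate j xs" by blast
      then have "p dvd j" using indep ys xs \<open>xs \<noteq> ys\<close> by blast
      then have "?w ^ j = ?w ^ 0"
        by (intro root_power_cong[OF cis_power_self[OF p0]]) (simp add: cong_0_iff)
      then show ?thesis using rot_char_eq[OF L(1) ne p0 pl j] by simp
    qed (simp add: rot_char_def)
    then show "\<chi> xs (cycle_of_list ys) = 1"
      using cyc[OF ys] cycM[OF ys] by (simp add: \<chi>_def sym_group_carrier)
  qed
qed

section \<open>Counting\<close>

text \<open>Only multiples of \<open>p\<close> contribute, which gives Legendre's recursion: the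
  exponent in \<open>n!\<close> is \<open>n div p\<close> plus the exponent in
  \<open>(n div p)!\<close>. Induction finishes, since \<open>2 * (n div p) \<le> n\<close>.\<close>

lemma multiplicity_fact_less:
  assumes "prime p" "n > 0"
  shows "multiplicity p (fact n :: nat) < n"
  using assms(2)
proof (induction n rule: less_induct)
  case (less n)
  let ?d = "n div p"
  have p1: "p > 1" using assms(1) prime_gt_1_nat by blast
  have sum: "multiplicity p (fact m :: nat) = (\<Sum>i=1..m. multiplicity p i)" for m
    unfolding fact_prod using assms(1)
    by (simp add: prime_elem_multiplicity_prod_distrib)
  have "multiplicity p (fact n :: nat) = (\<Sum>i\<in>(*) p ` {1..?d}. multiplicity p i)"
    unfolding sum
  proof (rule sum.mono_neutral_right)
    show "(*) p ` {1..?d} \<subseteq> {1..n}"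
      using p1 by (auto simp: less_eq_div_iff_mult_less_eq mult.commute)
    show "\<forall>i\<in>{1..n} - (*) p ` {1..?d}. multiplicity p i = 0"
    proof
      fix i assume i: "i \<in> {1..n} - (*) p ` {1..?d}"
      have "\<not> p dvd i"
      proof
        assume "p dvd i"
        then obtain t where "i = p * t" by blast
        then show False using i p1 by (auto simp: less_eq_div_iff_mult_less_eq mult.commute)
      qed
      then show "multiplicity p i = 0" by (rule not_dvd_imp_multiplicity_0)
    qed
  qed simp
  also have "\<dots> = (\<Sum>i=1..?d. multiplicity p (p * i))"
    using p1 by (subst sum.reindex) (auto simp: inj_on_def)
  also have "\<dots> = (\<Sum>i=1..?d. Suc (multiplicity p i))"
    using p1 by (intro sum.cong) (auto simp: multiplicity_times_same)
  also have "\<dots> = ?d + multiplicity p (fact ?d :: nat)"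
    by (simp add: sum sum_Suc)
  finally have eq: "multiplicity p (fact n :: nat) = ?d + multiplicity p (fact ?d :: nat)" .
  show ?case
  proof (cases "?d = 0")
    case True
    then show ?thesis using eq less.prems by simp
  next
    case False
    have "2 * ?d \<le> n"
      using p1 by (metis Suc_1 Suc_leI div_times_less_eq_dividend mult.commute mult_le_mono1 order_trans)
    moreover have "multiplicity p (fact ?d :: nat) < ?d"
      using less.IH[of ?d] False p1 less.prems by simp
    ultimately show ?thesis using eq by linarith
  qed
qed

text \<open>In Pascal's rule one summand is at least \<open>n\<close> by induction and the other at
  least 1; \<open>k = n\<close> is the boundary case.\<close>

lemma le_binomial:
  assumes "1 \<le> k" "k < n"
  shows "n \<le> n choose k"
  using assms
proof (induction n arbitrary: k)
  case (Suc n)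
  show ?case
  proof (cases "k = n")
    case False
    then obtain j where k: "k = Suc j" "k < n" using Suc.prems by (cases k) auto
    have "1 \<le> n choose j" using k by (simp add: Suc_leI)
    moreover have "n \<le> n choose k" using Suc.IH Suc.prems k by simp
    ultimately show ?thesis unfolding k(1) by (simp del: One_nat_def)
  qed (simp add: binomial_symmetric[of n "Suc n"])
qed simp

section \<open>Families of long cycles\<close>

text \<open>Serves the case \<open>q < n\<close>, with one cycle for each \<open>q\<close>-subset.
  Different supports of equal size leave a point of \<open>ys\<close> outside \<open>xs\<close>; the
  cycle of \<open>xs\<close> fixes it, and a rotation with a fixed point has shift 0 modulo
  \<open>q\<close>.\<close>

lemma family_of_supports:
  fixes n q :: nat
  assumes "1 \<le> q" "q < n" "p dvd q"
  defines "I \<equiv> sorted_list_of_set ` {S. S \<subseteq> {1..n} \<and> card S = q}"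
  shows "finite I" "n \<le> card I"
    and "\<And>xs. xs \<in> I \<Longrightarrow> distinct xs \<and> length xs = q \<and> set xs \<subseteq> {1..n}"
    and "\<And>xs ys j. xs \<in> I \<Longrightarrow> ys \<in> I \<Longrightarrow> xs \<noteq> ys \<Longrightarrow>
           map (cycle_of_list xs) ys = rotate j ys \<Longrightarrow> p dvd j"
proof -
  let ?F = "{S. S \<subseteq> {1..n} \<and> card S = q}"
  have finS: "finite S" if "S \<in> ?F" for S using that finite_subset by auto
  show "finite I" by (simp add: I_def)
  have "inj_on sorted_list_of_set ?F"
    by (rule inj_onI) (metis finS set_sorted_list_of_set)
  then have "card I = n choose q" by (simp add: I_def card_image n_subsets)
  then show "n \<le> card I" using le_binomial assms by simp
  show L: "distinct xs \<and> length xs = q \<and> set xs \<subseteq> {1..n}" if "xs \<in> I" for xs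
  proof -
    obtain S where S: "S \<subseteq> {1..n}" "card S = q" "xs = sorted_list_of_set S"
      using \<open>xs \<in> I\<close> I_def by blast
    then have "finite S" using finS by blast
    then show ?thesis using S by simp
  qed
  fix xs ys j
  assume xs: "xs \<in> I" and ys: "ys \<in> I" and neq: "xs \<noteq> ys"
    and rot: "map (cycle_of_list xs) ys = rotate j ys"
  have sorted: "sorted_list_of_set (set zs) = zs" if "zs \<in> I" for zs
  proof -
    obtain S where "S \<in> ?F" "zs = sorted_list_of_set S"
      using \<open>zs \<in> I\<close> I_def by blast
    then show ?thesis using finS[of S] by simp
  qed
  have "set xs \<noteq> set ys" using sorted[OF xs] sorted[OF ys] neq by metis
  moreover have "card (set xs) = card (set ys)" using L[OF xs] L[OF ys] distinct_card by metis
  ultimately have "\<not> set ys \<subseteq> set xs" by (metis List.finite_set card_subset_eq)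
  then obtain i where i: "i < q" "ys ! i \<notin> set xs" using L[OF ys] by (metis in_set_conv_nth subsetI)
  have "ys ! i = rotate j ys ! i"
    using arg_cong[OF rot, of "\<lambda>l. l ! i"] i L[OF ys] id_outside_supp[OF i(2)] by simp
  then have "i = (j + i) mod q"
    using i L[OF ys] by (simp add: nth_rotate nth_eq_iff_index_eq)
  then have "[j + i = 0 + i] (mod q)" using i by (simp add: cong_def)
  then have "[j = 0] (mod q)" by (simp only: cong_add_rcancel_nat)
  then show "p dvd j" using assms(3) by (meson cong_0_iff dvd_trans)
qed

text \<open>Serves the case \<open>q = n\<close>, where all supports coincide. Starting every list
  with 1, 2 forces any rotation of \<open>ys\<close> by the cycle of \<open>xs\<close> to have shift
  1, so both cycles agree and \<open>xs = ys\<close>; the divisibility claim is then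
  vacuous.\<close>

lemma family_of_full_cycles:
  fixes n :: nat
  assumes "2 \<le> n"
  defines "I \<equiv> (\<lambda>zs. 1 # 2 # zs) ` permutations_of_set {3..n}"
  shows "finite I" "card I = fact (n - 2)"
    and "\<And>xs. xs \<in> I \<Longrightarrow> distinct xs \<and> length xs = n \<and> set xs \<subseteq> {1..n}"
    and "\<And>xs ys j. xs \<in> I \<Longrightarrow> ys \<in> I \<Longrightarrow> xs \<noteq> ys \<Longrightarrow>
           map (cycle_of_list xs) ys = rotate j ys \<Longrightarrow> p dvd j"
proof -
  show "finite I" by (simp add: I_def)
  have "card I = card (permutations_of_set {3..n})"
    unfolding I_def by (rule card_image) (auto simp: inj_on_def)
  then show "card I = fact (n - 2)" by (simp add: numeral_3_eq_3 numeral_2_eq_2)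
  show L: "distinct xs \<and> length xs = n \<and> set xs \<subseteq> {1..n}" if "xs \<in> I" for xs
  proof -
    obtain zs where zs: "xs = 1 # 2 # zs" "set zs = {3..n}" "distinct zs"
      using \<open>xs \<in> I\<close> by (auto simp: I_def permutations_of_set_def)
    then have "length zs = n - 2" using distinct_card[of zs] by simp
    then show ?thesis using zs assms(1) by auto
  qed
  have start: "xs ! 0 = 1" "xs ! 1 = 2" if "xs \<in> I" for xs
    using that by (auto simp: I_def)
  fix xs ys j
  assume xs: "xs \<in> I" and ys: "ys \<in> I" and neq: "xs \<noteq> ys"
    and rot: "map (cycle_of_list xs) ys = rotate j ys"
  have step: "cycle_of_list xs (xs ! i) = xs ! Suc i" if "Suc i < n" for i
    using arg_cong[OF cyclic_rotation[of xs 1], of "\<lambda>l. l ! i"] L[OF xs] that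
    by (simp add: nth_rotate1)
  \<comment> \<open>The cycle of \<open>xs\<close> takes 1 to 2, and these are neighbours in
    \<open>ys\<close> as well.\<close>
  have "ys ! 1 = rotate j ys ! 0"
    using arg_cong[OF rot, of "\<lambda>l. l ! 0"] step[of 0] start[OF xs] start[OF ys] L[OF ys] assms(1)
    by simp
  then have "1 = j mod n"
    using L[OF ys] assms(1) by (simp add: nth_rotate nth_eq_iff_index_eq)
  then have rot1: "map (cycle_of_list xs) ys = rotate 1 ys"
    using rot L[OF ys] by (metis rotate_conv_mod)
  have "xs ! i = ys ! i" if "i < n" for i
    using that
  proof (induction i)
    case 0
    then show ?case using start xs ys by simp
  next
    case (Suc i)
    have "cycle_of_list xs (ys ! i) = ys ! Suc i"
      using arg_cong[OF rot1, of "\<lambda>l. l ! i"] L[OF ys] Suc.prems by (simp add: nth_rotate1)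
    then show ?case using step[OF Suc.prems] Suc by simp
  qed
  then have "xs = ys" using L[OF xs] L[OF ys] by (intro nth_equalityI) auto
  then show "p dvd j" using neq by simp
qed

text \<open>For \<open>n = q = 4\<close> the previous family has only two members, while the exponent of \<open>2\<close> in \<open>4!\<close>
  is \<open>3\<close>.\<close>

lemma family_of_4_cycles:
  assumes "I = {[1, 2, 3, 4], [1, 3, 2, 4], [1, 2, 4, 3 :: nat]}"
    and "xs \<in> I" "ys \<in> I" "xs \<noteq> ys" "map (cycle_of_list xs) ys = rotate j ys"
  shows "2 dvd j"
proof (rule ccontr)
  assume odd: "\<not> 2 dvd j"
  \<comment> \<open>Only a generator or its inverse remains to be excluded: the three lists
    represent the three cyclic subgroups generated by 4-cycles.\<close>
  have "j mod 4 = 1 \<or> j mod 4 = 3" using odd by presburger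
  moreover have "rotate j ys = rotate (j mod 4) ys"
    using assms(1,3) rotate_conv_mod[of j ys] by auto
  ultimately have
    "map (cycle_of_list xs) ys = rotate 1 ys \<or> map (cycle_of_list xs) ys = rotate 3 ys"
    using assms(5) by metis
  then show False using assms(1-4)
    by (auto simp: transpose_def numeral_3_eq_3)
qed

text \<open>The inequality fails for \<open>n = 3\<close> and \<open>n = 4\<close>, which is why
  these values are treated separately.\<close>

lemma pred_le_fact:
  assumes "n \<ge> 5"
  shows "n - 1 \<le> (fact (n - 2) :: nat)"
proof -
  obtain m where n: "n = m + 5" using assms le_Suc_ex by (metis add.commute)
  have "m + 4 \<le> (fact (m + 3) :: nat)"
  proof (induction m)
    case (Suc m)
    have "Suc m + 4 \<le> 2 * (m + 4)" by simp
    also have "\<dots> \<le> (m + 4) * fact (m + 3)" using Suc by (intro mult_mono) auto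
    also have "\<dots> = fact (Suc m + 3)" using fact_Suc[of "m + 3", where 'a = nat] by (simp add: add.commute)
    finally show ?case .
  qed (simp add: fact_numeral)
  then show ?thesis by (simp add: n add.commute)
qed

section \<open>Divisibility for one prime at a time\<close>

lemma prime_power_dvd_order:
  assumes p: "prime p" and n: "n > 0"
  shows "p ^ multiplicity p (fact n :: nat) dvd order (semicharacter_group (sym_group n))"
proof (cases "p \<le> n")
  case False
  then have "multiplicity p (fact n :: nat) = 0"
    using p by (simp add: not_dvd_imp_multiplicity_0 prime_dvd_fact_iff)
  then show ?thesis by simp
next
  case True
  let ?v = "multiplicity p (fact n :: nat)"
  have p1: "p > 1" using p prime_gt_1_nat by blast
  \<comment> \<open>The largest power of \<open>p\<close> up to \<open>n\<close>; maximality gives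
    the upper bound that rules out \<open>p\<close> disjoint translates of a support.\<close>
  obtain k where k: "p ^ k \<le> n" "n < p * p ^ k"
    using ex_power_ivl1[of p n] p1 n by auto
  have k0: "k > 0" using k True by (cases k) auto
  have pq: "p dvd p ^ k" using k0 by (simp add: dvd_power)
  have v: "?v < n" using multiplicity_fact_less[OF p n] .
  note main = prime_power_card_dvd_order[OF p k0 k]
  have weaken: "p ^ ?v dvd order (semicharacter_group (sym_group n))"
    if "?v \<le> c" "p ^ c dvd order (semicharacter_group (sym_group n))" for c
    using that power_le_dvd by blast
  show ?thesis
  proof (cases "p ^ k < n")
    case True
    have "1 \<le> p ^ k" using p1 by simp
    note F = family_of_supports[OF this True pq]
    show ?thesis
    proof (rule weaken)
      show "?v \<le> card (sorted_list_of_set ` {S. S \<subseteq> {1..n} \<and> card S = p ^ k})"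
        using F(2) v by linarith
    qed (rule main[OF F(1,3,4)])
  next
    case False
    then have nq: "n = p ^ k" using k by simp
    have n2: "2 \<le> n" using True p1 by simp
    show ?thesis
    proof (cases "n = 4")
      case True
      have "p dvd 4" using pq nq True by simp
      then have "p dvd 2 ^ 2" by simp
      then have p2: "p = 2" using p by (metis prime_dvd_power primes_dvd_imp_eq two_is_prime_nat)
      let ?I = "{[1, 2, 3, 4], [1, 3, 2, 4], [1, 2, 4, 3 :: nat]}"
      show ?thesis
      proof (rule weaken)
        show "?v \<le> card ?I" using v True by simp
        show "p ^ card ?I dvd order (semicharacter_group (sym_group n))"
        proof (rule main)
          show "distinct xs \<and> length xs = p ^ k \<and> set xs \<subseteq> {1..n}" if "xs \<in> ?I" for xs
            using that unfolding nq[symmetric] True by auto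
          show "p dvd j" if "xs \<in> ?I" "ys \<in> ?I" "xs \<noteq> ys" "map (cycle_of_list xs) ys = rotate j ys"
            for xs ys j
            using family_of_4_cycles[OF refl that] p2 by simp
        qed simp
      qed
    next
      case False
      note F = family_of_full_cycles[OF n2]
      have "?v \<le> fact (n - 2)"
      proof (cases "n \<ge> 5")
        case True
        then show ?thesis using pred_le_fact[of n] v by linarith
      next
        case False
        then have "n = 2 \<or> n = 3" using n2 \<open>n \<noteq> 4\<close> by auto
        then show ?thesis
        proof
          assume "n = 2"
          then show ?thesis using v by simp
        next
          assume n3: "n = 3"
          \<comment> \<open>The general bound only gives exponent at most 2 while the family has one
            member, so the exponent of 3 in \<open>3!\<close> is computed exactly.\<close>
          have "p dvd 3" using pq nq n3 by simp
          moreover have "prime (3 :: nat)" by simp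
          ultimately have "p = 3" using p primes_dvd_imp_eq by blast
          moreover have "multiplicity 3 (3 * 2 :: nat) = Suc (multiplicity 3 (2 :: nat))"
            by (rule multiplicity_times_same) auto
          moreover have "multiplicity 3 (2 :: nat) = 0"
            by (rule not_dvd_imp_multiplicity_0) simp
          ultimately show ?thesis using n3 by (simp add: fact_numeral)
        qed
      qed
      then show ?thesis using F(2) main[OF F(1) _ F(4)] F(3) nq by (intro weaken) auto
    qed
  qed
qed

theorem theorem4p2:
  fixes n :: nat
  assumes "n \<ge> 1"
  shows "order (sym_group n) = fact n \<and>
         order (sym_group n) dvd order (semicharacter_group (sym_group n))"
proof
  show "order (sym_group n) = fact n" by (rule order_sym_group)
  \<comment> \<open>Multiplicities bound divisors only of a nonzero number, and \<open>order\<close>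
    is 0 for an infinite carrier; finiteness and the neutral element exclude this.\<close>
  have "finite (semicharacters (sym_group n))"
    using sym_group_is_group
    by (rule finite_semicharacters) (simp add: sym_group_def finite_permutations)
  then have nz: "order (semicharacter_group (sym_group n)) \<noteq> 0"
    using monoid.one_closed[OF comm_monoid.axioms(1)[OF comm_group.axioms(1)[OF
          comm_group_semicharacter_group[OF sym_group_is_group[of n]]]]]
    by (auto simp: order_def semicharacter_group_def)
  show "order (sym_group n) dvd order (semicharacter_group (sym_group n))"
    unfolding order_sym_group
  proof (rule multiplicity_le_imp_dvd)
    fix p :: nat assume p: "prime p"
    show "multiplicity p (fact n :: nat) \<le> multiplicity p (order (semicharacter_group (sym_group n)))"
      using prime_power_dvd_order[OF p, of n] assms nz p
      by (intro multiplicity_geI) auto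
  qed simp
qed

end
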